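(* Let $q\in\mathbb{N}$ with $q\ge 3$ and let $A\subset\mathbb{Q}$ be a finite set with $\#A\ge 2$. The following statements are equivalent. (i) $\dim_H K(q,A)<1$; (ii) the set $K(q,A)$ has empty interior in $\mathbb{R}$; (iii) $\#\big(D_p\cap K(q,A)\big)<+\infty$ for every integer $p\ge 2$ with $\gcd(p,q)=1$.
   Context: $\mathbb{N}=\{1,2,3,\ldots\}$; $\#$ denotes cardinality and $\dim_H$ denotes Hausdorff dimension. For an integer $q\ge 2$ and a finite set $A\subset\mathbb{Q}$, $K(q,A)=\big\{\sum_{i=1}^{\infty}\frac{a_i}{q^i}: a_i\in A\ \text{for all } i\in\mathbb{N}\big\}$ (the self-similar set in $\mathbb{R}$ generated by the maps $x\mapsto (x+a)/q$, $a\in A$). For an integer $p\ge 2$, $D_p=\bigcup_{n=1}^{\infty}\frac{\mathbb{Z}}{p^n}$, where $\frac{\mathbb{Z}}{p^n}=\{m/p^n: m\in\mathbb{Z}\}$; this is the set of all rational numbers having a finite $p$-ary expansion. *)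

theory Defs
  imports "HOL-Analysis.Analysis"
begin

text \<open>
  The weight \<open>(diam U)\<^sup>s\<close> of a covering set, with the usual conventions that the empty set
  has weight 0 and that \<open>0\<^sup>0 = 1\<close>. The case \<open>s = 0\<close> is separate because
  \<^term>\<open>(0::real) powr 0 = 0\<close>.
\<close>

definition hausdorff_weight :: "real \<Rightarrow> 'a::metric_space set \<Rightarrow> ennreal" where
  "hausdorff_weight s U =
     (if U = {} then 0 else if s = 0 then 1 else ennreal (diameter U powr s))"

text \<open>
  Covers by at most countably many sets are sequences of sets, padded by empty sets.
  Boundedness is required explicitly because \<^const>\<open>diameter\<close> is real-valued, hence
  unspecified on unbounded sets.
\<close>

definition hausdorff_covers :: "real \<Rightarrow> 'a::metric_space set \<Rightarrow> (nat \<Rightarrow> 'a set) set" where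
  "hausdorff_covers \<delta> E =
     {U. E \<subseteq> (\<Union>i. U i) \<and> (\<forall>i. bounded (U i) \<and> diameter (U i) \<le> \<delta>)}"

definition hausdorff_premeasure :: "real \<Rightarrow> real \<Rightarrow> 'a::metric_space set \<Rightarrow> ennreal" where
  "hausdorff_premeasure s \<delta> E = (INF U \<in> hausdorff_covers \<delta> E. \<Sum>i. hausdorff_weight s (U i))"

definition hausdorff_measure :: "real \<Rightarrow> 'a::metric_space set \<Rightarrow> ennreal" where
  "hausdorff_measure s E = (SUP \<delta> \<in> {0<..}. hausdorff_premeasure s \<delta> E)"

definition hausdorff_dim :: "'a::metric_space set \<Rightarrow> ennreal" where
  "hausdorff_dim E = (INF s \<in> {s. 0 \<le> s \<and> hausdorff_measure s E = 0}. ennreal s)"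

text \<open>The digit \<open>a i\<close> here is the digit \<open>a\<^sub>i\<^sub>+\<^sub>1\<close> of the expansion, whose indices start at 1.\<close>

definition digit_set :: "nat \<Rightarrow> real set \<Rightarrow> real set" where
  "digit_set q A = {x. \<exists>a. (\<forall>i. a i \<in> A) \<and> (\<lambda>i. a i / real q ^ Suc i) sums x}"

definition finite_expansions :: "nat \<Rightarrow> real set" where
  "finite_expansions p = (\<Union>n\<in>{1..}. {real_of_int m / real p ^ n | m. True})"

end

theory Submission
  imports Defs "HOL-Number_Theory.Number_Theory"
begin

text \<open>
  Write \<open>K\<close> for the digit set and choose a positive integer \<open>L\<close> with \<open>L A \<subseteq> \<int>\<close>. Removing the first
  digit shows \<open>q K \<subseteq> A + K\<close>, so \<open>G = L K + \<int>\<close> satisfies \<open>q G \<subseteq> G\<close>: modulo 1, the orbit of a point of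
  \<open>L K\<close> under multiplication by \<open>q\<close> never leaves \<open>L K\<close>. If \<open>K\<close> has empty interior, then
  so has \<open>G\<close>, because \<open>K\<close> is compact and on a bounded interval \<open>G\<close> is a finite union of translates
  of \<open>L K\<close>. Hence some arc of the circle \<open>\<real> / \<int>\<close> is avoided by all these orbits
  (\<open>orbit_gap_digit_set\<close>). Both remaining statements follow from this one arc.

  Dimension: the arc contains an interval \<open>[j/Q, (j+1)/Q)\<close>, where \<open>Q\<close> is a power of \<open>q\<close>. So a
  fixed digit never occurs in the base-\<open>Q\<close> expansions of the points of \<open>L K\<close>, and a constant times
  \<open>(Q - 1)\<^sup>k\<close> intervals of length \<open>Q\<^sup>-\<^sup>k\<close> cover \<open>L K\<close>
  (\<open>card_floor_image_orbit_gap\<close>). This makes the dimension at most \<open>log\<^sub>Q (Q - 1) < 1\<close>.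

  Finiteness: let \<open>m/d\<close> be a reduced fraction, \<open>d\<close> a divisor of a power of \<open>p\<close>. The powers of
  \<open>q\<^sup>N\<close>, with \<open>N\<close> chosen such that \<open>q\<^sup>N = 1 + u\<close> and \<open>p\<^sup>2\<close> divides \<open>u\<close>, are the numbers
  \<open>1 + u f\<close> with \<open>f\<close> a geometric sum, and these sums run through all residues modulo \<open>d\<close>. So the
  orbit of \<open>m/d\<close> modulo 1 contains \<open>m/d + u w/d\<close> for every integer \<open>w\<close> and comes closer than
  \<open>u/d\<close> to every point (\<open>orbit_of_fraction_dense\<close>). As \<open>u\<close> depends on \<open>p\<close> and \<open>q\<close> only, the arc can
  be avoided only by fractions of bounded denominator, and a bounded set contains finitely
  many of those.

  Conversely, a set of dimension less than 1 is Lebesgue null and so has empty interior; and if \<open>K\<close>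
  contains an interval, then it contains infinitely many of the fractions \<open>m/p\<^sup>n\<close> for \<open>p = q + 1\<close>,
  as these are dense; and \<open>q + 1\<close> is coprime to \<open>q\<close>.
\<close>

section \<open>Digit sets\<close>

lemma digit_set_shift:
  assumes "x \<in> digit_set q A" and "q > 0"
  shows "\<exists>a\<in>A. \<exists>y\<in>digit_set q A. real q * x = a + y"
proof -
  obtain a where a: "\<And>i. a i \<in> A" and s: "(\<lambda>i. a i / real q ^ Suc i) sums x"
    using assms(1) unfolding digit_set_def by blast
  have "(\<lambda>i. a (Suc i) / real q ^ Suc (Suc i)) sums (x - a 0 / real q)"
    using s by (subst sums_Suc_iff) simp
  then have "(\<lambda>i. real q * (a (Suc i) / real q ^ Suc (Suc i))) sums (real q * (x - a 0 / real q))"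
    by (rule sums_mult)
  moreover have "real q * (a (Suc i) / real q ^ Suc (Suc i)) = a (Suc i) / real q ^ Suc i" for i
    using assms(2) by (simp add: field_simps)
  moreover have "real q * (x - a 0 / real q) = real q * x - a 0"
    using assms(2) by (simp add: field_simps)
  ultimately have "(\<lambda>i. a (Suc i) / real q ^ Suc i) sums (real q * x - a 0)"
    by simp
  then have "real q * x - a 0 \<in> digit_set q A"
    unfolding digit_set_def using a by (auto intro!: exI[of _ "\<lambda>i. a (Suc i)"])
  then show ?thesis
    using a[of 0] by (intro bexI[of _ "a 0"] bexI[of _ "real q * x - a 0"]) auto
qed

text \<open>
  Iterating the step hypothesis expands \<open>x\<close> into \<open>n\<close> digits plus a remainder \<open>y\<^sub>n / q\<^sup>n\<close> with
  \<open>y\<^sub>n \<in> B\<close>. Boundedness of \<open>B\<close> sends the remainder to 0.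
\<close>

lemma digit_set_coinduct:
  assumes "q \<ge> 2" and "bounded B"
    and step: "\<And>x. x \<in> B \<Longrightarrow> \<exists>a\<in>A. \<exists>y\<in>B. real q * x = a + y"
  shows "B \<subseteq> digit_set q A"
proof
  fix x assume x: "x \<in> B"
  obtain f g where fg: "\<And>x. x \<in> B \<Longrightarrow> f x \<in> A \<and> g x \<in> B \<and> real q * x = f x + g x"
    using step by metis
  obtain C where C: "\<And>y. y \<in> B \<Longrightarrow> \<bar>y\<bar> \<le> C"
    using assms(2) by (auto simp: bounded_iff)
  define y where "y n = (g ^^ n) x" for n
  have yB: "y n \<in> B" for n
    by (induction n) (use x fg in \<open>auto simp: y_def\<close>)
  have partial: "(\<Sum>i<n. f (y i) / real q ^ Suc i) = x - y n / real q ^ n" for n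
  proof (induction n)
    case (Suc n)
    have "real q * y n = f (y n) + y (Suc n)"
      using fg[OF yB[of n]] by (simp add: y_def)
    then have "f (y n) = real q * y n - y (Suc n)" by simp
    then have "f (y n) / real q ^ Suc n = y n / real q ^ n - y (Suc n) / real q ^ Suc n"
      using assms(1) by (simp add: diff_divide_distrib)
    then show ?case using Suc by simp
  qed (simp add: y_def)
  have "(\<lambda>n. y n / real q ^ n) \<longlonglongrightarrow> 0"
  proof (rule Lim_null_comparison)
    show "\<forall>\<^sub>F n in sequentially. norm (y n / real q ^ n) \<le> C * (1 / real q) ^ n"
      using C[OF yB] by (auto simp: power_divide divide_right_mono)
    show "(\<lambda>n. C * (1 / real q) ^ n) \<longlonglongrightarrow> 0"
      using assms(1) by (intro tendsto_mult_right_zero LIMSEQ_realpow_zero) auto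
  qed
  then have "(\<lambda>n. x - y n / real q ^ n) \<longlonglongrightarrow> x - 0"
    by (intro tendsto_intros)
  then have "(\<lambda>i. f (y i) / real q ^ Suc i) sums x"
    unfolding sums_def partial by simp
  then show "x \<in> digit_set q A"
    unfolding digit_set_def using fg[OF yB] by (intro CollectI exI[of _ "\<lambda>i. f (y i)"]) auto
qed

lemma bounded_digit_set:
  assumes "q \<ge> 2" and "bounded A"
  shows "bounded (digit_set q A)"
proof -
  obtain C where C: "\<And>a. a \<in> A \<Longrightarrow> \<bar>a\<bar> \<le> C"
    using assms(2) by (auto simp: bounded_iff)
  define T where "T = (\<Sum>i. C * (1 / real q) ^ Suc i)"
  have "summable (\<lambda>i. C * (1 / real q) ^ Suc i)"
    using assms(1) by (intro summable_mult summable_ignore_initial_segment[of _ 1, simplified]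
        summable_geometric) auto
  then have T: "(\<lambda>i. C * (1 / real q) ^ Suc i) sums T"
    unfolding T_def by (rule summable_sums)
  have "\<bar>x\<bar> \<le> T" if x: "x \<in> digit_set q A" for x
  proof -
    obtain a where a: "\<And>i. a i \<in> A" and s: "(\<lambda>i. a i / real q ^ Suc i) sums x"
      using x unfolding digit_set_def by blast
    have b: "\<bar>a i / real q ^ Suc i\<bar> \<le> C * (1 / real q) ^ Suc i" for i
      using C[OF a[of i]] by (simp add: power_divide divide_right_mono)
    have "x \<le> T"
      using b by (intro sums_le[OF _ s T]) (meson abs_le_D1)
    moreover have "- x \<le> T"
      using b by (intro sums_le[OF _ sums_minus[OF s] T]) (meson abs_le_D2)
    ultimately show ?thesis by simp
  qed
  then show ?thesis by (auto simp: bounded_iff)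
qed

text \<open>
  Closedness comes from coinduction applied to the closure of \<open>K\<close>. The union of the compact sets
  \<open>(a + closure K) / q\<close> over the finitely many digits contains \<open>K\<close>, hence contains its closure,
  so that every point of the closure has a first digit with remainder in the closure.
\<close>

lemma compact_digit_set:
  assumes "q \<ge> 2" and "finite A"
  shows "compact (digit_set q A)"
proof -
  let ?K = "digit_set q A"
  let ?U = "\<Union>a\<in>A. (\<lambda>y. (a + y) / real q) ` closure ?K"
  have bdd: "bounded ?K"
    using assms by (intro bounded_digit_set finite_imp_bounded)
  then have "compact ?U"
    using assms by (intro compact_UN compact_continuous_image continuous_intros)
      (auto simp: compact_closure)
  moreover have "?K \<subseteq> ?U"
  proof
    fix x assume "x \<in> ?K"
    then obtain a y where "a \<in> A" "y \<in> ?K" "real q * x = a + y"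
      using digit_set_shift[of x q A] assms by auto
    moreover from this have "x = (a + y) / real q"
      using assms by (simp add: field_simps)
    ultimately show "x \<in> ?U"
      using closure_subset[of ?K] by blast
  qed
  ultimately have sub: "closure ?K \<subseteq> ?U"
    by (intro closure_minimal compact_imp_closed)
  have "closure ?K \<subseteq> ?K"
  proof (rule digit_set_coinduct)
    fix x assume "x \<in> closure ?K"
    then obtain a y where "a \<in> A" "y \<in> closure ?K" "x = (a + y) / real q"
      using sub by blast
    then show "\<exists>a\<in>A. \<exists>y\<in>closure ?K. real q * x = a + y"
      using assms by (intro bexI[of _ a] bexI[of _ y]) auto
  qed (use assms bdd in auto)
  then have "closed ?K"
    using closure_subset_eq by blast
  then show ?thesis
    using bdd by (simp add: compact_eq_bounded_closed)
qed

section \<open>An arc that every orbit avoids\<close>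

lemma common_denominator:
  assumes "finite A" and "A \<subseteq> \<rat>"
  shows "\<exists>L::nat. L > 0 \<and> (\<forall>a\<in>A. real L * a \<in> \<int>)"
  using assms
proof (induction rule: finite_induct)
  case (insert a A)
  then obtain L where L: "L > 0" "\<forall>a\<in>A. real L * a \<in> \<int>" by auto
  obtain m n where mn: "n > 0" "a = of_int m / of_int n"
    using insert.prems by (auto elim: Rats_cases')
  have "real (L * nat n) * a = of_int (int L * m)"
    using mn by simp
  then have "real (L * nat n) * a \<in> \<int>" by (metis Ints_of_int)
  moreover have "real (L * nat n) * b \<in> \<int>" if "b \<in> A" for b
  proof -
    have "real (nat n) * (real L * b) \<in> \<int>"
      using L that by (simp add: Ints_mult)
    then show ?thesis by (simp add: mult_ac)
  qed
  ultimately show ?case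
    using L(1) mn(1) by (intro exI[of _ "L * nat n"]) auto
qed (auto intro: exI[of _ 1])

lemma interior_finite_Union_closed_empty:
  assumes "finite F" and "\<And>S. S \<in> F \<Longrightarrow> closed S \<and> interior S = {}"
  shows "interior (\<Union>F) = {}"
  using assms
proof (induction rule: finite_induct)
  case (insert S F)
  then show ?case
    by (simp add: interior_closed_Un_empty_interior)
qed simp

text \<open>
  Only the translates by integers in \<open>{-R..R}\<close> meet the unit interval. Their union is closed with
  empty interior, so a whole ball in the unit interval misses it, and with it all translates.
\<close>

lemma integer_translates_miss_arc:
  fixes K :: "real set"
  assumes "compact K" and "interior K = {}"
  shows "\<exists>t \<epsilon>. \<epsilon> > 0 \<and> (\<forall>y\<in>K. \<forall>z::int. \<epsilon> \<le> \<bar>y + of_int z - t\<bar>)"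
proof -
  obtain C where C: "\<And>y. y \<in> K \<Longrightarrow> \<bar>y\<bar> \<le> C"
    using compact_imp_bounded[OF assms(1)] by (auto simp: bounded_iff)
  define R where "R = \<lceil>C\<rceil> + 1"
  define F where "F = (\<lambda>z. (\<lambda>y. of_int z + y) ` K) ` {-R..R}"
  have F: "closed S \<and> interior S = {}" if "S \<in> F" for S
    using that assms by (auto simp: F_def interior_translation closed_translation compact_imp_closed)
  have "finite F" by (simp add: F_def)
  then have "interior (\<Union>F) = {}"
    using F by (rule interior_finite_Union_closed_empty)
  then have "\<not> {0<..<1} \<subseteq> \<Union>F"
    using interior_maximal[of "{0<..<1::real}" "\<Union>F"] by auto
  then obtain t where t: "t \<in> {0<..<1}" "t \<notin> \<Union>F" by blast
  have "open ({0<..<1} - \<Union>F)"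
    using F \<open>finite F\<close> by (intro open_Diff closed_Union) auto
  then obtain e where e: "e > 0" "ball t e \<subseteq> {0<..<1} - \<Union>F"
    using t unfolding open_contains_ball by blast
  have "e \<le> \<bar>y + of_int z - t\<bar>" if "y \<in> K" for y and z :: int
  proof (rule ccontr)
    assume "\<not> e \<le> \<bar>y + of_int z - t\<bar>"
    then have "of_int z + y \<in> ball t e"
      by (simp add: dist_real_def)
    then have in01: "of_int z + y \<in> {0<..<1}" and notF: "of_int z + y \<notin> \<Union>F"
      using e by auto
    have "z \<in> {-R..R}"
      using in01 C[OF that] unfolding R_def by (auto; linarith)
    then show False
      using notF that by (auto simp: F_def)
  qed
  then show ?thesis using e(1) by blast
qed

text \<open>
  Since \<open>z\<close> ranges over all integers, this is a statement on the circle \<open>\<real> / \<int>\<close>: the orbits of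
  the points of \<open>S\<close> under multiplication by \<open>q\<close> stay at distance at least \<open>\<epsilon>\<close> from \<open>t\<close>.
\<close>

definition orbit_gap :: "nat \<Rightarrow> real \<Rightarrow> real \<Rightarrow> real set \<Rightarrow> bool" where
  "orbit_gap q t \<epsilon> S \<longleftrightarrow> (\<forall>x\<in>S. \<forall>n. \<forall>z::int. \<epsilon> \<le> \<bar>real q ^ n * x + of_int z - t\<bar>)"

text \<open>
  Each multiplication by \<open>q\<close> splits off a digit \<open>a\<close>; scaled by \<open>L\<close> it is an integer and
  disappears modulo 1.
\<close>

lemma digit_set_orbit:
  assumes "q > 0" and L: "\<And>a. a \<in> A \<Longrightarrow> real L * a \<in> \<int>" and "x \<in> digit_set q A"
  shows "\<exists>y\<in>digit_set q A. \<exists>z::int. real q ^ n * (real L * x) = real L * y + of_int z"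
proof (induction n)
  case 0
  show ?case using assms(3) by (intro bexI[of _ x] exI[of _ 0]) auto
next
  case (Suc n)
  then obtain y and z :: int where y: "y \<in> digit_set q A"
      and eq: "real q ^ n * (real L * x) = real L * y + of_int z" by blast
  obtain a y' where a: "a \<in> A" and y': "y' \<in> digit_set q A" and "real q * y = a + y'"
    using digit_set_shift[OF y assms(1)] by blast
  moreover obtain w where "real L * a = of_int w"
    using L[OF a] by (auto elim: Ints_cases)
  moreover have "real q ^ Suc n * (real L * x) = real L * (real q * y) + real q * of_int z"
    using arg_cong[OF eq, of "\<lambda>v. real q * v"] by (simp add: algebra_simps)
  ultimately have "real q ^ Suc n * (real L * x) = real L * y' + of_int (w + int q * z)"
    by (simp add: algebra_simps)
  then show ?case using y' by blast
qed

lemma orbit_gap_digit_set: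
  assumes "q \<ge> 2" and "finite A" and "L > 0" and "\<And>a. a \<in> A \<Longrightarrow> real L * a \<in> \<int>"
    and "interior (digit_set q A) = {}"
  shows "\<exists>t \<epsilon>. \<epsilon> > 0 \<and> orbit_gap q t \<epsilon> ((*) (real L) ` digit_set q A)"
proof -
  let ?K = "(*\<^sub>R) (real L) ` digit_set q A"
  have "compact ?K"
    using assms by (intro compact_scaling compact_digit_set)
  moreover have "interior ?K = {}"
    using assms interior_injective_linear_image[of "(*\<^sub>R) (real L)" "digit_set q A"]
    by (simp add: inj_on_def linear_scaleR)
  ultimately obtain t \<epsilon> where "\<epsilon> > 0" and gap: "\<forall>y\<in>?K. \<forall>z::int. \<epsilon> \<le> \<bar>y + of_int z - t\<bar>"
    using integer_translates_miss_arc by blast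
  have "\<epsilon> \<le> \<bar>real q ^ n * (real L * x) + of_int z - t\<bar>" if "x \<in> digit_set q A" for x n and z :: int
  proof -
    obtain y w where "y \<in> digit_set q A" and eq: "real q ^ n * (real L * x) = real L * y + of_int w"
      using digit_set_orbit[of q A L x n] assms \<open>x \<in> digit_set q A\<close> by auto
    then have "\<epsilon> \<le> \<bar>real L * y + of_int (w + z) - t\<bar>"
      using gap by (auto simp del: of_int_add)
    then show ?thesis by (simp add: eq add.assoc)
  qed
  then show ?thesis
    using \<open>\<epsilon> > 0\<close> unfolding orbit_gap_def by blast
qed

section \<open>Bounds for the Hausdorff dimension\<close>

lemma hausdorff_premeasure_le_finite_cover:
  assumes "finite \<U>" and "E \<subseteq> \<Union>\<U>" and "\<And>U. U \<in> \<U> \<Longrightarrow> bounded U \<and> diameter U \<le> \<delta>" and "\<delta> \<ge> 0"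
  shows "hausdorff_premeasure s \<delta> E \<le> (\<Sum>U\<in>\<U>. hausdorff_weight s U)"
proof -
  obtain h where h: "bij_betw h {..<card \<U>} \<U>"
    using ex_bij_betw_nat_finite[OF assms(1)] by (auto simp: atLeast0LessThan)
  define V where "V i = (if i < card \<U> then h i else {})" for i
  have "\<Union>\<U> = (\<Union>i<card \<U>. h i)"
    using h by (auto simp: bij_betw_def)
  then have "E \<subseteq> (\<Union>i. V i)"
    using assms(2) by (fastforce simp: V_def)
  moreover have "bounded (V i) \<and> diameter (V i) \<le> \<delta>" for i
    using assms(3,4) bij_betwE[OF h] by (auto simp: V_def)
  ultimately have "V \<in> hausdorff_covers \<delta> E"
    by (auto simp: hausdorff_covers_def)
  then have "hausdorff_premeasure s \<delta> E \<le> (\<Sum>i. hausdorff_weight s (V i))"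
    unfolding hausdorff_premeasure_def by (rule INF_lower)
  also have "\<dots> = (\<Sum>i<card \<U>. hausdorff_weight s (V i))"
    by (rule suminf_finite) (auto simp: V_def hausdorff_weight_def)
  also have "\<dots> = (\<Sum>i<card \<U>. hausdorff_weight s (h i))"
    by (simp add: V_def)
  also have "\<dots> = (\<Sum>U\<in>\<U>. hausdorff_weight s U)"
    by (rule sum.reindex_bij_betw[OF h])
  finally show ?thesis .
qed

text \<open>
  A set covered by about \<open>(Q - 1)\<^sup>k\<close> pieces of size about \<open>Q\<^sup>-\<^sup>k\<close> has \<open>s\<close>-dimensional Hausdorff measure
  0 as soon as \<open>Q\<^sup>s > Q - 1\<close>, since then the total weight decays geometrically in \<open>k\<close>.
\<close>

lemma hausdorff_dim_less_one_if_few_covering_sets: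
  fixes E :: "'a::metric_space set" and Q :: nat
  assumes "Q \<ge> 2" and "c \<ge> 0"
    and cover: "\<And>k. \<exists>\<U>. finite \<U> \<and> E \<subseteq> \<Union>\<U> \<and> card \<U> \<le> C * (Q - 1) ^ k \<and>
                  (\<forall>U\<in>\<U>. bounded U \<and> diameter U \<le> c / real Q ^ k)"
  shows "hausdorff_dim E < 1"
proof -
  \<comment> \<open>Any number strictly between \<open>Q - 1\<close> and \<open>Q\<close> would do in place of \<open>Q - 1/2\<close>.\<close>
  define s where "s = log (real Q) (real Q - 1/2)"
  have s: "0 < s" "s < 1"
    using assms(1) by (auto simp: s_def)
  have Qs: "real Q powr s = real Q - 1/2"
    using assms(1) by (simp add: s_def)
  define \<rho> where "\<rho> = real (Q - 1) / real Q powr s"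
  have \<rho>: "0 \<le> \<rho>" "\<rho> < 1"
    using assms(1) by (auto simp: \<rho>_def Qs of_nat_diff)
  have bound: "hausdorff_premeasure s \<delta> E \<le> ennreal (real C * c powr s * \<rho> ^ k)"
    if \<delta>: "c / real Q ^ k \<le> \<delta>" for \<delta> k
  proof -
    obtain \<U> where U: "finite \<U>" "E \<subseteq> \<Union>\<U>" "card \<U> \<le> C * (Q - 1) ^ k"
        "\<And>U. U \<in> \<U> \<Longrightarrow> bounded U \<and> diameter U \<le> c / real Q ^ k"
      using cover[of k] by blast
    let ?w = "(c / real Q ^ k) powr s"
    have "0 \<le> c / real Q ^ k" using assms(2) by simp
    then have "0 \<le> \<delta>" using \<delta> by linarith
    then have "hausdorff_premeasure s \<delta> E \<le> (\<Sum>U\<in>\<U>. hausdorff_weight s U)"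
      using U \<delta> by (intro hausdorff_premeasure_le_finite_cover) (auto intro: order_trans)
    also have "\<dots> \<le> (\<Sum>U\<in>\<U>. ennreal ?w)"
      using U(4) s(1)
      by (intro sum_mono) (auto simp: hausdorff_weight_def intro!: ennreal_leI powr_mono2 diameter_ge_0)
    also have "\<dots> = ennreal (real (card \<U>) * ?w)"
      by (simp add: ennreal_mult ennreal_of_nat_eq_real_of_nat)
    also have "\<dots> \<le> ennreal (real (C * (Q - 1) ^ k) * ?w)"
      using U(3) by (intro ennreal_leI mult_right_mono) (auto simp del: of_nat_mult of_nat_power)
    also have "real (C * (Q - 1) ^ k) * ?w = real C * c powr s * \<rho> ^ k"
    proof -
      have "(real Q ^ k) powr s = (real Q powr s) ^ k"
        using assms(1) by (simp add: powr_powr mult.commute flip: powr_realpow)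
      then show ?thesis
        using assms(2) by (simp add: powr_divide \<rho>_def power_divide)
    qed
    finally show ?thesis .
  qed
  have "hausdorff_premeasure s \<delta> E = 0" if "\<delta> > 0" for \<delta>
  proof -
    have "(\<lambda>k. c * (1 / real Q) ^ k) \<longlonglongrightarrow> 0"
      using assms(1) by (intro tendsto_mult_right_zero LIMSEQ_realpow_zero) auto
    then have "\<forall>\<^sub>F k in sequentially. c * (1 / real Q) ^ k < \<delta>"
      using \<open>\<delta> > 0\<close> by (rule order_tendstoD)
    then have ev: "\<forall>\<^sub>F k in sequentially. hausdorff_premeasure s \<delta> E \<le> ennreal (real C * c powr s * \<rho> ^ k)"
      by (rule eventually_mono) (auto intro!: bound simp: power_divide)
    have "(\<lambda>k. real C * c powr s * \<rho> ^ k) \<longlonglongrightarrow> 0"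
      using \<rho> by (intro tendsto_mult_right_zero LIMSEQ_realpow_zero)
    then have "(\<lambda>k. ennreal (real C * c powr s * \<rho> ^ k)) \<longlonglongrightarrow> ennreal 0"
      by (rule tendsto_ennrealI)
    then have "hausdorff_premeasure s \<delta> E \<le> ennreal 0"
      using ev by (rule tendsto_lowerbound) simp
    then show ?thesis by simp
  qed
  then have "hausdorff_measure s E = 0"
    by (auto simp: hausdorff_measure_def)
  then have "hausdorff_dim E \<le> ennreal s"
    unfolding hausdorff_dim_def using s by (intro INF_lower) auto
  also have "\<dots> < 1" using s by (simp add: ennreal_less_one_iff)
  finally show ?thesis .
qed

text \<open>
  For some \<open>s < 1\<close> there are covers by sets of diameter at most 1 with arbitrarily small total
  weight. On such sets the weight dominates the diameter, and a set of diameter \<open>d\<close> lies in an interval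
  of length \<open>2 d\<close>; so \<open>E\<close> has Lebesgue outer measure 0 and cannot contain an interval.
\<close>

lemma interior_empty_if_hausdorff_dim_less_one:
  fixes E :: "real set"
  assumes "hausdorff_dim E < 1"
  shows "interior E = {}"
proof (rule ccontr)
  assume "interior E \<noteq> {}"
  then obtain x e where e: "e > 0" "cball x e \<subseteq> E"
    by (auto simp: mem_interior_cball)
  obtain s where s: "0 \<le> s" "hausdorff_measure s E = 0" "ennreal s < 1"
    using assms unfolding hausdorff_dim_def INF_less_iff by auto
  have s1: "s < 1" using s by (simp add: ennreal_less_one_iff)
  have "hausdorff_premeasure s 1 E \<le> hausdorff_measure s E"
    unfolding hausdorff_measure_def by (intro SUP_upper) auto
  then have "hausdorff_premeasure s 1 E < ennreal (e / 2)"
    using s e by simp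
  then obtain U where U: "U \<in> hausdorff_covers 1 E"
      and small: "(\<Sum>i. hausdorff_weight s (U i)) < ennreal (e / 2)"
    unfolding hausdorff_premeasure_def INF_less_iff by blast
  have cov: "E \<subseteq> (\<Union>i. U i)" and bd: "bounded (U i)" and di: "diameter (U i) \<le> 1" for i
    using U by (auto simp: hausdorff_covers_def)
  \<comment> \<open>The covering sets need not be measurable, hence the passage to balls.\<close>
  define V where "V i = (if U i = {} then {} else cball (SOME y. y \<in> U i) (diameter (U i)))" for i
  have UV: "U i \<subseteq> V i" for i
  proof
    fix y assume y: "y \<in> U i"
    then have "(SOME y. y \<in> U i) \<in> U i" by (rule someI)
    then show "y \<in> V i"
      using diameter_bounded_bound[OF bd[of i]] y by (auto simp: V_def)
  qed
  have sub: "cball x e \<subseteq> (\<Union>i. V i)"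
  proof (rule subsetI)
    fix y assume "y \<in> cball x e"
    then have "y \<in> (\<Union>i. U i)" using e(2) cov by (meson subsetD)
    then show "y \<in> (\<Union>i. V i)" using UV by auto
  qed
  have Vw: "emeasure lborel (V i) \<le> 2 * hausdorff_weight s (U i)" for i
  proof (cases "U i = {}")
    case False
    let ?d = "diameter (U i)"
    have d0: "0 \<le> ?d" using diameter_ge_0[OF bd] .
    have "emeasure lborel (V i) = ennreal (2 * ?d)"
      using False d0 by (simp add: V_def cball_eq_atLeastAtMost)
    also have "\<dots> = 2 * ennreal ?d"
      using d0 by (simp add: ennreal_mult)
    also have "ennreal ?d \<le> hausdorff_weight s (U i)"
    proof (cases "s = 0")
      case True
      then show ?thesis using False di[of i] by (simp add: hausdorff_weight_def)
    next
      case s0: False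
      have "?d \<le> ?d powr s"
      proof (cases "?d = 0")
        case False
        then show ?thesis
          using powr_mono'[of s 1 ?d] s1 d0 di[of i] by simp
      qed simp
      then show ?thesis using False s0 by (simp add: hausdorff_weight_def ennreal_leI)
    qed
    finally show ?thesis by (simp add: mult_left_mono)
  qed (simp add: V_def)
  have "ennreal (2 * e) = emeasure lborel (cball x e)"
    using e by (simp add: cball_eq_atLeastAtMost)
  also have "\<dots> \<le> emeasure lborel (\<Union>i. V i)"
    using sub by (intro emeasure_mono) (auto simp: V_def)
  also have "\<dots> \<le> (\<Sum>i. emeasure lborel (V i))"
    by (intro emeasure_subadditive_countably) (auto simp: V_def)
  also have "\<dots> \<le> (\<Sum>i. 2 * hausdorff_weight s (U i))"
    using Vw by (intro suminf_le) auto
  also have "\<dots> = 2 * (\<Sum>i. hausdorff_weight s (U i))"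
    by simp
  also have "\<dots> \<le> 2 * ennreal (e / 2)"
    using small by (intro mult_left_mono) auto
  also have "\<dots> = ennreal e"
    using e ennreal_mult[of 2 "e/2"] by simp
  finally show False using e by simp
qed

text \<open>
  The integer \<open>\<lfloor>Q\<^sup>k x\<rfloor>\<close> records the first \<open>k\<close> base-\<open>Q\<close> digits of \<open>x\<close> after the point, together with the
  integer part. If \<open>j\<close> denotes the integer with \<open>t \<in> [j/Q, (j+1)/Q)\<close>, this interval has length at
  most \<open>\<epsilon>\<close> and so lies within \<open>\<epsilon>\<close> of \<open>t\<close>. The digit \<open>j mod Q\<close> therefore never occurs, which leaves
  \<open>Q - 1\<close> continuations at each step.
\<close>

lemma card_floor_image_orbit_gap:
  assumes "orbit_gap Q t \<epsilon> S" and "Q > 0" and "1 / real Q \<le> \<epsilon>" and "bounded S"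
  defines "W \<equiv> \<lambda>k. (\<lambda>x. \<lfloor>real Q ^ k * x\<rfloor>) ` S"
  shows "finite (W k)" and "card (W k) \<le> card (W 0) * (Q - 1) ^ k"
proof -
  define j where "j = \<lfloor>t * real Q\<rfloor>"
  have digit: "\<lfloor>real Q ^ Suc k * x\<rfloor> mod int Q \<noteq> j mod int Q" if x: "x \<in> S" for k x
  proof
    let ?w = "\<lfloor>real Q ^ Suc k * x\<rfloor>"
    assume "?w mod int Q = j mod int Q"
    then obtain z where "?w - j = int Q * z"
      by (metis mod_eq_dvd_iff dvdE)
    then have "real_of_int ?w = real_of_int (j + int Q * z)"
      by (simp add: algebra_simps)
    then have "real_of_int j \<le> real Q ^ Suc k * x - real Q * z"
        "real Q ^ Suc k * x - real Q * z < real_of_int j + 1"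
      by (auto; linarith)+
    moreover have "real_of_int j \<le> t * real Q" "t * real Q < real_of_int j + 1"
      by (auto simp: j_def)
    ultimately have "\<bar>real Q ^ Suc k * x - real Q * z - t * real Q\<bar> < 1"
      by linarith
    moreover have "real Q ^ Suc k * x - real Q * z - t * real Q
        = real Q * (real Q ^ k * x + of_int (- z) - t)"
      by (simp add: algebra_simps)
    ultimately have "real Q * \<bar>real Q ^ k * x + of_int (- z) - t\<bar> < 1"
      by (simp add: abs_mult)
    moreover have "\<epsilon> \<le> \<bar>real Q ^ k * x + of_int (- z) - t\<bar>"
      using assms(1) x unfolding orbit_gap_def by blast
    then have "1 / real Q \<le> \<bar>real Q ^ k * x + of_int (- z) - t\<bar>"
      using assms(3) by linarith
    then have "1 \<le> real Q * \<bar>real Q ^ k * x + of_int (- z) - t\<bar>"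
      using assms(2) by (simp add: field_simps)
    ultimately show False by linarith
  qed
  define D where "D = {0..<int Q} - {j mod int Q}"
  have D: "finite D" "card D = Q - 1"
    using assms(2) by (auto simp: D_def)
  have step: "W (Suc k) \<subseteq> (\<lambda>(w, i). int Q * w + i) ` (W k \<times> D)" for k
  proof
    fix v assume "v \<in> W (Suc k)"
    then obtain x where x: "x \<in> S" and v: "v = \<lfloor>real Q ^ Suc k * x\<rfloor>"
      by (auto simp: W_def)
    have "v div int Q = \<lfloor>real_of_int v / real Q\<rfloor>"
      using floor_divide_of_int_eq[where ?'a = real, of v "int Q"] by simp
    also have "\<dots> = \<lfloor>real Q ^ Suc k * x / real Q\<rfloor>"
      unfolding v using floor_divide_real_eq_div[of "int Q" "real Q ^ Suc k * x"]
        floor_divide_of_int_eq[of "\<lfloor>real Q ^ Suc k * x\<rfloor>" "int Q"] by simp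
    also have "real Q ^ Suc k * x / real Q = real Q ^ k * x"
      using assms(2) by simp
    finally have "v div int Q \<in> W k"
      using x by (auto simp: W_def)
    moreover have "v mod int Q \<in> D"
      using digit[OF x, of k] assms(2) by (auto simp: D_def v)
    moreover have "v = int Q * (v div int Q) + v mod int Q" by simp
    ultimately show "v \<in> (\<lambda>(w, i). int Q * w + i) ` (W k \<times> D)"
      by (intro image_eqI[of _ _ "(v div int Q, v mod int Q)"]) auto
  qed
  obtain C where C: "\<And>x. x \<in> S \<Longrightarrow> \<bar>x\<bar> \<le> C"
    using assms(4) by (auto simp: bounded_iff)
  have "finite (W k) \<and> card (W k) \<le> card (W 0) * (Q - 1) ^ k"
  proof (induction k)
    case 0
    have "W 0 \<subseteq> {\<lfloor>- C\<rfloor>..\<lfloor>C\<rfloor>}"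
      using C by (fastforce simp: W_def abs_le_iff intro!: floor_mono)
    then show ?case using finite_subset by auto
  next
    case (Suc k)
    have fin: "finite (W k \<times> D)" using Suc D by simp
    have "card (W (Suc k)) \<le> card ((\<lambda>(w, i). int Q * w + i) ` (W k \<times> D))"
      using fin step by (intro card_mono) auto
    also have "\<dots> \<le> card (W k \<times> D)"
      using fin by (rule card_image_le)
    also have "\<dots> = card (W k) * (Q - 1)"
      by (simp add: card_cartesian_product D)
    also have "\<dots> \<le> card (W 0) * (Q - 1) ^ k * (Q - 1)"
      using Suc by simp
    finally have "card (W (Suc k)) \<le> card (W 0) * (Q - 1) ^ Suc k"
      by (simp add: mult_ac)
    moreover have "finite (W (Suc k))"
      using finite_subset[OF step] fin by blast
    ultimately show ?case by blast
  qed
  then show "finite (W k)" and "card (W k) \<le> card (W 0) * (Q - 1) ^ k" by auto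
qed

lemma hausdorff_dim_less_one_if_orbit_gap:
  fixes E :: "real set"
  assumes "q \<ge> 2" and "\<epsilon> > 0" and "L > 0" and "bounded E" and "orbit_gap q t \<epsilon> ((*) L ` E)"
  shows "hausdorff_dim E < 1"
proof -
  have "(\<lambda>n. (1 / real q) ^ n) \<longlonglongrightarrow> 0"
    using assms(1) by (intro LIMSEQ_realpow_zero) auto
  then have "\<forall>\<^sub>F n in sequentially. (1 / real q) ^ n < \<epsilon>"
    using assms(2) by (rule order_tendstoD)
  then obtain M where "\<forall>n\<ge>M. (1 / real q) ^ n < \<epsilon>"
    by (auto simp: eventually_sequentially)
  then have M: "1 / real q ^ Suc M < \<epsilon>"
    by (metis Suc_n_not_le_n nat_le_linear power_one_over)
  define Q where "Q = q ^ Suc M"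
  have Q: "Q \<ge> 2"
    using assms(1) self_le_power[of q "Suc M"] by (simp add: Q_def del: power_Suc)
  define S where "S = (*) L ` E"
  have "bounded S"
    using bounded_scaling[OF assms(4), of L] by (simp add: S_def)
  have "orbit_gap Q t \<epsilon> S"
    using assms(5) unfolding orbit_gap_def Q_def S_def
    by (auto simp flip: power_mult simp del: power_Suc)
  note W = card_floor_image_orbit_gap[OF this _ _ \<open>bounded S\<close>]
  define W where "W k = (\<lambda>x. \<lfloor>real Q ^ k * x\<rfloor>) ` S" for k
  have W: "finite (W k)" "card (W k) \<le> card (W 0) * (Q - 1) ^ k" for k
    using W[of k] Q M assms(1) by (simp_all add: W_def Q_def del: power_Suc)
  show ?thesis
  proof (rule hausdorff_dim_less_one_if_few_covering_sets[OF Q, of "1 / L"])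
    fix k
    define I where "I w = {of_int w / (L * real Q ^ k) .. (of_int w + 1) / (L * real Q ^ k)}" for w :: int
    have pos: "L * real Q ^ k > 0" using assms(3) Q by simp
    have "E \<subseteq> \<Union> (I ` W k)"
    proof
      fix x assume x: "x \<in> E"
      let ?w = "\<lfloor>real Q ^ k * (L * x)\<rfloor>"
      have "of_int ?w \<le> x * (L * real Q ^ k)" "x * (L * real Q ^ k) \<le> of_int ?w + 1"
        using floor_correct[of "real Q ^ k * (L * x)"] by (auto simp: mult_ac)
      then have "x \<in> I ?w"
        using pos by (simp add: I_def divide_le_eq le_divide_eq)
      then show "x \<in> \<Union> (I ` W k)" using x by (auto simp: W_def S_def)
    qed
    moreover have "diameter (I w) = 1 / L / real Q ^ k" for w
      using pos by (simp add: I_def diameter_closed_interval divide_right_mono add_divide_distrib)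
    moreover have "card (I ` W k) \<le> card (W 0) * (Q - 1) ^ k"
      using W[of k] card_image_le[of "W k" I] by linarith
    ultimately show "\<exists>\<U>. finite \<U> \<and> E \<subseteq> \<Union>\<U> \<and> card \<U> \<le> card (W 0) * (Q - 1) ^ k \<and>
        (\<forall>U\<in>\<U>. bounded U \<and> diameter U \<le> 1 / L / real Q ^ k)"
      using W[of k] by (intro exI[of _ "I ` W k"]) (auto simp: I_def)
  qed (use assms in auto)
qed

section \<open>Orbits of rational points\<close>

lemma geometric_sum_add:
  fixes b :: "'a::comm_semiring_1"
  shows "(\<Sum>i<k + l. b ^ i) = (\<Sum>i<k. b ^ i) + b ^ k * (\<Sum>i<l. b ^ i)"
  by (induction l) (auto simp: power_add algebra_simps)

lemma geometric_sum_mult: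
  fixes b :: "'a::comm_semiring_1"
  shows "(\<Sum>i<s * r. b ^ i) = (\<Sum>i<s. b ^ i) * (\<Sum>j<r. (b ^ s) ^ j)"
proof (induction r)
  case (Suc r)
  have "(\<Sum>i<s * Suc r. b ^ i) = (\<Sum>i<s * r + s. b ^ i)"
    by (simp add: add.commute)
  then show ?case
    by (simp add: geometric_sum_add Suc.IH power_mult distrib_left) (simp add: mult.commute)
qed simp

text \<open>
  A form of the lifting-the-exponent lemma, by induction on \<open>d\<close>, splitting off a prime factor \<open>r\<close>.
  As \<open>b\<close> is 1 modulo \<open>r\<close>, the sum is congruent to \<open>s\<close>, so \<open>s = r s'\<close>. The sum of length \<open>r s'\<close> is the
  sum of length \<open>s'\<close> times a geometric sum \<open>T\<close> of length \<open>r\<close>, and \<open>T\<close> is congruent to \<open>r\<close> modulo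
  \<open>p\<^sup>2\<close>. Hence \<open>T = r c\<close> with \<open>c\<close> coprime to \<open>p\<close>, and \<open>d / r\<close> divides the sum of length \<open>s'\<close>. The
  modulus \<open>p\<^sup>2\<close> instead of \<open>p\<close> is what makes \<open>c\<close> coprime to \<open>p\<close>; modulo \<open>p\<close> the claim fails for
  \<open>p = 2\<close>, \<open>b = 3\<close>, where \<open>1 + 3\<close> is divisible by 4.
\<close>

lemma dvd_if_dvd_geometric_sum:
  fixes b p d s :: nat
  assumes "p > 0" and b: "[b = 1] (mod p\<^sup>2)" and "d dvd p ^ n" and "d dvd (\<Sum>i<s. b ^ i)"
  shows "d dvd s"
  using assms(3,4)
proof (induction d arbitrary: s rule: less_induct)
  case (less d)
  have "d > 0" using less.prems(1) assms(1) by (metis dvd_pos_nat zero_less_power)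
  show ?case
  proof (cases "d = 1")
    case False
    then obtain r where r: "prime r" "r dvd d" using prime_factor_nat by blast
    have "r dvd p ^ n" using r(2) less.prems(1) by (rule dvd_trans)
    then have rp: "r dvd p" using r(1) prime_dvd_power by blast
    have sum_pow: "[(\<Sum>i<k. (b ^ l) ^ i) = k] (mod p\<^sup>2)" for k l
    proof -
      have "[(\<Sum>i<k. (b ^ l) ^ i) = (\<Sum>i<k. (1 ^ l) ^ i)] (mod p\<^sup>2)"
        by (intro cong_sum cong_pow b)
      then show ?thesis by simp
    qed
    have "[(\<Sum>i<s. b ^ i) = s] (mod r)"
      using sum_pow[of 1 s] rp by (auto intro: cong_dvd_modulus_nat simp: power2_eq_square)
    moreover have "r dvd (\<Sum>i<s. b ^ i)" using r(2) less.prems(2) by (rule dvd_trans)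
    ultimately have "r dvd s" using cong_dvd_iff by blast
    then obtain s' where s': "s = r * s'" by blast
    obtain d' where d': "d = r * d'" using r(2) by blast
    obtain p' where p': "p = r * p'" using rp by blast
    have r0: "r > 0" using r(1) by (simp add: prime_gt_0_nat)
    define T where "T = (\<Sum>j<r. (b ^ s') ^ j)"
    have T: "[T = r] (mod p\<^sup>2)" unfolding T_def by (rule sum_pow)
    then have "r dvd T"
      using cong_dvd_modulus_nat[OF T, of r] rp cong_dvd_iff[of T r r]
      by (auto simp: power2_eq_square)
    then obtain c where c: "T = r * c" by blast
    have "[r * c = r * 1] (mod r * (p' * p))"
      using T by (simp add: c p' power2_eq_square mult_ac)
    then have "[c = 1] (mod p' * p)"
      using r0 by (simp add: cong_def mult_mod_right[symmetric])
    then have "[c = 1] (mod p)" by (rule cong_dvd_modulus_nat) simp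
    then have "coprime c p" by (metis cong_imp_coprime cong_sym coprime_1_left)
    then have "coprime c (p ^ n)" by simp
    moreover have "d' dvd p ^ n" using less.prems(1) d' dvd_mult_right by blast
    ultimately have cop: "coprime d' c"
      by (meson coprime_commute coprime_divisors dvd_refl)
    have "(\<Sum>i<s. b ^ i) = (\<Sum>i<s'. b ^ i) * T"
      unfolding T_def s' mult.commute[of r] by (rule geometric_sum_mult)
    then have "r * d' dvd r * (c * (\<Sum>i<s'. b ^ i))"
      using less.prems(2) by (simp add: d' c mult_ac)
    then have "d' dvd c * (\<Sum>i<s'. b ^ i)" using r0 by simp
    then have "d' dvd (\<Sum>i<s'. b ^ i)"
      using cop by (simp add: coprime_dvd_mult_right_iff)
    moreover have "d' < d"
      using d' \<open>d > 0\<close> prime_gt_1_nat[OF r(1)] by simp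
    ultimately have "d' dvd s'"
      using less.IH \<open>d' dvd p ^ n\<close> by blast
    then show ?thesis by (simp add: s' d')
  qed simp
qed

text \<open>
  The sums of length \<open>k < d\<close> are pairwise distinct modulo \<open>d\<close>: two of them differ by a unit times a
  sum of length less than \<open>d\<close>, and \<open>d\<close> does not divide that. Being \<open>d\<close> in number, they exhaust
  the residues.
\<close>

lemma geometric_sum_residues_complete:
  fixes b p d :: nat
  assumes "p > 0" and b: "[b = 1] (mod p\<^sup>2)" and d: "d dvd p ^ n"
  shows "\<exists>k. [int (\<Sum>i<k. b ^ i) = t] (mod int d)"
proof -
  let ?f = "\<lambda>k. (\<Sum>i<k. b ^ i)"
  have "d > 0" using d assms(1) by (metis dvd_pos_nat zero_less_power)
  have "[b = 1] (mod p)"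
    using b by (rule cong_dvd_modulus_nat) (simp add: power2_eq_square)
  then have "coprime b p" by (metis cong_imp_coprime cong_sym coprime_1_left)
  then have "coprime b (p ^ n)" by simp
  then have bd: "coprime b d" using d by (meson coprime_divisors dvd_refl)
  have neq: "?f k mod d \<noteq> ?f l mod d" if "k < l" "l < d" for k l
  proof
    assume "?f k mod d = ?f l mod d"
    then have "[?f k + b ^ k * ?f (l - k) = ?f k + 0] (mod d)"
      using geometric_sum_add[of b k "l - k"] that by (simp add: cong_def)
    then have "[b ^ k * ?f (l - k) = 0] (mod d)"
      by (simp only: cong_add_lcancel_nat)
    then have "d dvd b ^ k * ?f (l - k)" by (simp add: cong_0_iff)
    moreover have "coprime d (b ^ k)" using bd by (simp add: coprime_commute)
    ultimately have "d dvd ?f (l - k)" by (simp add: coprime_dvd_mult_right_iff)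
    then have "d dvd l - k" by (rule dvd_if_dvd_geometric_sum[OF assms(1) b d])
    then show False using that by (auto dest: dvd_imp_le)
  qed
  have "inj_on (\<lambda>k. ?f k mod d) {..<d}"
  proof (rule inj_onI)
    fix k l assume "k \<in> {..<d}" "l \<in> {..<d}" "?f k mod d = ?f l mod d"
    then show "k = l" using neq[of k l] neq[of l k] by (cases k l rule: linorder_cases) auto
  qed
  then have "(\<lambda>k. ?f k mod d) ` {..<d} = {..<d}"
    using \<open>d > 0\<close> by (intro endo_inj_surj) auto
  moreover have "nat (t mod int d) \<in> {..<d}"
    using \<open>d > 0\<close> by (simp add: nat_less_iff)
  ultimately obtain k where "nat (t mod int d) = ?f k mod d" by (metis (no_types, lifting) imageE)
  then have "int (?f k mod d) = t mod int d"
    using \<open>d > 0\<close> by (metis int_nat_eq of_nat_0_less_iff pos_mod_sign)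
  then show ?thesis by (intro exI[of _ k]) (simp add: cong_def zmod_int del: of_nat_sum)
qed

text \<open>
  With \<open>b = q\<^sup>N = 1 + u\<close> one has \<open>b\<^sup>k = 1 + u f\<close>, where \<open>f\<close> is the geometric sum of length \<open>k\<close>, so
  \<open>b\<^sup>k m/d = m/d + u m f/d\<close>. Since \<open>m\<close> is invertible and \<open>f\<close> arbitrary modulo \<open>d\<close>, this gives
  \<open>m/d + u w/d\<close> modulo 1 for any prescribed integer \<open>w\<close>.
\<close>

lemma orbit_of_fraction_dense:
  fixes p q :: nat
  assumes "p > 0" and "q \<ge> 2" and "coprime q p"
  shows "\<exists>u::nat. \<forall>(m::int) (d::nat) n t. coprime m (int d) \<longrightarrow> d dvd p ^ n \<longrightarrow>
           (\<exists>k (z::int). \<bar>real q ^ k * (of_int m / real d) + of_int z - t\<bar> < real u / real d)"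
proof -
  define N where "N = totient (p\<^sup>2)"
  define b where "b = q ^ N"
  define u where "u = b - 1"
  have "N > 0" using assms(1) by (simp add: N_def)
  have "b \<ge> 2"
    using self_le_power[of q N] assms(2) \<open>N > 0\<close> by (simp add: b_def)
  have u: "real b = 1 + real u" "u > 0" using \<open>b \<ge> 2\<close> by (auto simp: u_def)
  have b: "[b = 1] (mod p\<^sup>2)"
    unfolding b_def N_def using assms(3) by (intro euler_theorem) simp
  have "\<exists>k (z::int). \<bar>real q ^ k * (of_int m / real d) + of_int z - t\<bar> < real u / real d"
    if m: "coprime m (int d)" and d: "d dvd p ^ n" for m d n t
  proof -
    have d0: "d > 0" using d assms(1) by (metis dvd_pos_nat zero_less_power)
    define v where "v = t - of_int m / real d"
    \<comment> \<open>The multiple \<open>u w/d\<close> of the step \<open>u/d\<close> is the last one not exceeding the displacement \<open>v\<close>.\<close>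
    define w where "w = \<lfloor>v * real d / real u\<rfloor>"
    obtain m' where m': "[m * m' = 1] (mod int d)"
      using m cong_solve_coprime_int by blast
    obtain k where k: "[int (\<Sum>i<k. b ^ i) = m' * w] (mod int d)"
      using geometric_sum_residues_complete[OF assms(1) b d] by blast
    define f where "f = int (\<Sum>i<k. b ^ i)"
    have "[int u * (m * f) = int u * (m * (m' * w))] (mod int d)"
      using k unfolding f_def by (intro cong_scalar_left)
    also have "[int u * (m * (m' * w)) = int u * (1 * w)] (mod int d)"
      using cong_scalar_right[OF m', of w] by (intro cong_scalar_left) (simp add: mult_ac)
    finally have "[int u * (m * f) = int u * w] (mod int d)" by simp
    then obtain z where z: "int u * (m * f) = int u * w + int d * z"
      by (metis cong_iff_lin cong_sym)
    have "real b ^ k = 1 + real u * of_int f"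
      using power_diff_1_eq[of "real b" k] u by (simp add: f_def algebra_simps)
    then have "real q ^ (N * k) * (of_int m / real d)
        = of_int m / real d + of_int (int u * (m * f)) / real d"
      by (simp add: b_def power_mult algebra_simps add_divide_distrib)
    also have "\<dots> = of_int m / real d + real u * of_int w / real d + of_int z"
      unfolding z using d0 by (simp add: field_simps)
    finally have eq: "real q ^ (N * k) * (of_int m / real d) + of_int (- z) - t
        = real u * of_int w / real d - v" by (simp add: v_def)
    have "of_int w \<le> v * real d / real u" "v * real d / real u < of_int w + 1"
      unfolding w_def by linarith+
    then have "real u * of_int w / real d \<le> v"
      "v < real u * of_int w / real d + real u / real d"
      using u(2) d0 by (auto simp: field_simps)
    moreover have "\<bar>a - v\<bar> < c" if "a \<le> v" "v < a + c" for a c :: real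
      using that by linarith
    ultimately have "\<bar>real u * of_int w / real d - v\<bar> < real u / real d" by blast
    then show ?thesis using eq by metis
  qed
  then show ?thesis by blast
qed

text \<open>
  In lowest terms \<open>m/d\<close>, a point of the intersection has \<open>\<epsilon> < u/d\<close> by density of its orbit, which
  bounds \<open>d\<close>; boundedness of \<open>S\<close> then bounds \<open>m\<close>.
\<close>

lemma finite_fractions_if_orbit_gap:
  fixes p q :: nat
  assumes "p > 0" and "q \<ge> 2" and "coprime q p" and "\<epsilon> > 0" and "bounded S"
    and gap: "orbit_gap q t \<epsilon> S"
  shows "finite (finite_expansions p \<inter> S)"
proof -
  obtain u :: nat where u: "\<And>(m::int) (d::nat) n t. coprime m (int d) \<Longrightarrow> d dvd p ^ n \<Longrightarrow>
      \<exists>k (z::int). \<bar>real q ^ k * (of_int m / real d) + of_int z - t\<bar> < real u / real d"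
    using orbit_of_fraction_dense[OF assms(1-3)] by blast
  obtain C where C: "\<And>x. x \<in> S \<Longrightarrow> \<bar>x\<bar> \<le> C"
    using assms(5) by (auto simp: bounded_iff)
  define D where "D = real u / \<epsilon>"
  define X where "X = (\<lambda>(m, d). of_int m / real d) ` ({\<lfloor>- (C * D)\<rfloor>..\<lfloor>C * D\<rfloor>} \<times> {..nat \<lfloor>D\<rfloor>})"
  have "finite_expansions p \<inter> S \<subseteq> X"
  proof
    fix x assume "x \<in> finite_expansions p \<inter> S"
    then obtain m0 n where x: "x \<in> S" and xe: "x = of_int m0 / real p ^ n"
      by (auto simp: finite_expansions_def)
    have "gcd m0 (int (p ^ n)) \<noteq> 0" using assms(1) by simp
    then obtain m d where md: "m0 = m * gcd m0 (int (p ^ n))"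
        "int (p ^ n) = d * gcd m0 (int (p ^ n))" "coprime m d"
      using gcd_coprime_exists by blast
    have "0 < int (p ^ n)" using assms(1) by simp
    then have "d > 0"
      using md(2) by (metis gcd_ge_0_int zero_less_mult_pos2 mult_not_zero order_less_le)
    have "int (nat d) dvd int (p ^ n)"
      using md(2) \<open>d > 0\<close> by (metis dvd_triv_left int_nat_eq order_less_imp_le)
    then have dvd: "nat d dvd p ^ n" by (simp only: of_nat_dvd_iff)
    have "real p ^ n = of_int (int (p ^ n))" by simp
    then have xd: "x = of_int m / real (nat d)"
      unfolding xe using md(1,2) \<open>gcd m0 (int (p ^ n)) \<noteq> 0\<close> \<open>d > 0\<close>
      by (metis (no_types, opaque_lifting) mult_divide_mult_cancel_right of_int_0_eq_iff of_int_mult of_nat_nat order_less_imp_le)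
    obtain k and z :: int where kz: "\<bar>real q ^ k * x + of_int z - t\<bar> < real u / real (nat d)"
      using u[of m "nat d" n t] md(3) \<open>d > 0\<close> dvd xd by auto
    have "\<epsilon> \<le> \<bar>real q ^ k * x + of_int z - t\<bar>"
      using gap x unfolding orbit_gap_def by blast
    then have "\<epsilon> < real u / real (nat d)" using kz by (rule le_less_trans)
    then have dD: "real (nat d) \<le> D"
      using \<open>d > 0\<close> assms(4) by (simp add: D_def field_simps)
    have "\<bar>of_int m\<bar> = \<bar>x\<bar> * real (nat d)"
      using \<open>d > 0\<close> by (simp add: xd)
    also have "\<dots> \<le> C * D"
      using C[OF x] dD by (intro mult_mono) auto
    finally have "m \<in> {\<lfloor>- (C * D)\<rfloor>..\<lfloor>C * D\<rfloor>}"
      by (auto simp: abs_le_iff le_floor_iff floor_le_iff)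
    moreover have "nat d \<in> {..nat \<lfloor>D\<rfloor>}"
      using dD by (simp add: le_nat_floor)
    ultimately show "x \<in> X"
      unfolding X_def xd by (intro image_eqI[of _ _ "(m, nat d)"]) auto
  qed
  moreover have "finite X" by (simp add: X_def)
  ultimately show ?thesis using finite_subset by blast
qed

text \<open>
  Otherwise deleting the finitely many points of the intersection from the interior leaves a nonempty open
  set, and rounding one of its points down to \<open>n\<close> digits in base \<open>p\<close> gives a deleted point in it.
\<close>

lemma infinite_finite_expansions_Int:
  assumes "p \<ge> 2" and "interior E \<noteq> {}"
  shows "infinite (finite_expansions p \<inter> E)"
proof
  assume fin: "finite (finite_expansions p \<inter> E)"
  have "open (interior E - (finite_expansions p \<inter> E))"
    using fin by (intro open_Diff finite_imp_closed) auto
  moreover have "interior E - (finite_expansions p \<inter> E) \<noteq> {}"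
    using fin assms(2) by (metis Diff_eq_empty_iff finite_imp_not_open finite_subset open_interior)
  ultimately obtain x e where e: "e > 0" "ball x e \<subseteq> interior E - (finite_expansions p \<inter> E)"
    by (metis all_not_in_conv openE)
  have "(\<lambda>n. (1 / real p) ^ n) \<longlonglongrightarrow> 0"
    using assms(1) by (intro LIMSEQ_realpow_zero) auto
  then have "\<forall>\<^sub>F n in sequentially. (1 / real p) ^ n < e"
    using e(1) by (rule order_tendstoD)
  then obtain n where "\<forall>i\<ge>n. (1 / real p) ^ i < e"
    by (auto simp: eventually_sequentially)
  then have n: "1 / real p ^ Suc n < e"
    by (metis Suc_n_not_le_n nat_le_linear power_one_over)
  define P where "P = real p ^ Suc n"
  have P: "P > 0" "1 / P < e" using assms(1) n by (auto simp: P_def)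
  define y where "y = of_int \<lfloor>x * P\<rfloor> / P"
  have "y \<in> finite_expansions p"
    unfolding finite_expansions_def y_def P_def by (intro UN_I[of "Suc n"]) auto
  moreover have "y \<in> ball x e"
  proof -
    have "of_int \<lfloor>x * P\<rfloor> \<le> x * P" "x * P < of_int \<lfloor>x * P\<rfloor> + 1" by linarith+
    then have "y \<le> x" "x < y + 1 / P"
      using P(1) by (auto simp: y_def field_simps)
    then show ?thesis using P(2) by (simp add: dist_real_def)
  qed
  ultimately show False using e(2) interior_subset by blast
qed

section \<open>The equivalence\<close>

theorem theorem1p1:
  fixes q :: nat and A :: "real set"
  assumes "q \<ge> 3" and "A \<subseteq> \<rat>" and "finite A" and "card A \<ge> 2"
  shows "(hausdorff_dim (digit_set q A) < 1 \<longleftrightarrow> interior (digit_set q A) = {}) \<and>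
         (interior (digit_set q A) = {} \<longleftrightarrow>
           (\<forall>p::nat. p \<ge> 2 \<and> gcd p q = 1 \<longrightarrow>
             finite (finite_expansions p \<inter> digit_set q A)))"
proof -
  let ?K = "digit_set q A"
  have q: "q \<ge> 2" using assms(1) by simp
  have bdd: "bounded ?K"
    using q assms(3) by (intro bounded_digit_set finite_imp_bounded)
  obtain L :: nat where L: "L > 0" "\<And>a. a \<in> A \<Longrightarrow> real L * a \<in> \<int>"
    using common_denominator[OF assms(3,2)] by blast
  have bddL: "bounded ((*) (real L) ` ?K)"
    using bounded_scaling[OF bdd, of "real L"] by simp
  have gap: "\<exists>t \<epsilon>. \<epsilon> > 0 \<and> orbit_gap q t \<epsilon> ((*) (real L) ` ?K)" if "interior ?K = {}"
    using orbit_gap_digit_set[OF q assms(3) L that] .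
  have dim: "hausdorff_dim ?K < 1" if emp: "interior ?K = {}"
  proof -
    obtain t \<epsilon> where te: "\<epsilon> > 0" "orbit_gap q t \<epsilon> ((*) (real L) ` ?K)"
      using gap[OF emp] by blast
    show ?thesis
      using hausdorff_dim_less_one_if_orbit_gap[OF q te(1) _ bdd te(2)] L(1) by simp
  qed
  have fin: "finite (finite_expansions p \<inter> ?K)"
    if emp: "interior ?K = {}" and p: "p \<ge> 2" "gcd p q = 1" for p
  proof -
    obtain t \<epsilon> where te: "\<epsilon> > 0" "orbit_gap q t \<epsilon> ((*) (real L) ` ?K)"
      using gap[OF emp] by blast
    have "coprime q p" using p(2) by (metis coprime_iff_gcd_eq_1 gcd.commute)
    then have "finite (finite_expansions p \<inter> (*) (real L) ` ?K)"
      using finite_fractions_if_orbit_gap[OF _ q _ te(1) bddL te(2)] p(1) by simp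
    \<comment> \<open>Multiplication by \<open>L\<close> preserves the finite expansions, so it embeds the set in question.\<close>
    moreover have "real L * x \<in> finite_expansions p" if x: "x \<in> finite_expansions p" for x
    proof -
      obtain n m where "n \<ge> 1" "x = of_int m / real p ^ n"
        using x by (auto simp: finite_expansions_def)
      moreover from this have "real L * x = of_int (int L * m) / real p ^ n" by simp
      ultimately show ?thesis
        unfolding finite_expansions_def by (intro UN_I[of n] CollectI exI[of _ "int L * m"]) auto
    qed
    then have "(*) (real L) ` (finite_expansions p \<inter> ?K) \<subseteq> finite_expansions p \<inter> (*) (real L) ` ?K"
      by blast
    ultimately have "finite ((*) (real L) ` (finite_expansions p \<inter> ?K))"
      using finite_subset by blast
    moreover have "inj_on ((*) (real L)) (finite_expansions p \<inter> ?K)"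
      using L(1) by (simp add: inj_on_def)
    ultimately show ?thesis by (rule finite_imageD)
  qed
  have emp: "interior ?K = {}"
    if all: "\<forall>p::nat. p \<ge> 2 \<and> gcd p q = 1 \<longrightarrow> finite (finite_expansions p \<inter> ?K)"
  proof (rule ccontr)
    assume "interior ?K \<noteq> {}"
    have p: "q + 1 \<ge> 2" using q by simp
    have "gcd (q + 1) q = 1"
      using coprime_add_one_left[of q] by (rule coprime_imp_gcd_eq_1)
    with p have "finite (finite_expansions (q + 1) \<inter> ?K)"
      by (intro all[THEN spec, THEN mp] conjI)
    then show False
      using infinite_finite_expansions_Int[OF p \<open>interior ?K \<noteq> {}\<close>] by contradiction
  qed
  show ?thesis
  proof (intro conjI iffI allI impI)
    show "interior ?K = {}" if "hausdorff_dim ?K < 1"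
      using that by (rule interior_empty_if_hausdorff_dim_less_one)
    show "finite (finite_expansions p \<inter> ?K)"
      if "interior ?K = {}" "p \<ge> 2 \<and> gcd p q = 1" for p
      using that(2) by (elim conjE) (rule fin[OF that(1)])
  qed (fact dim emp)+
qed

end
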